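(* Let $r,m\in\mathbb{N}$, and let $f,g:\mathbb{N}^m\to\mathbb{N}$ be two polynomials of finite degree with no constant term such that $f\approx g$. If $\mathbb{N}=\bigcup_{i=1}^rA_i$ is any $r$-coloring, then there are two sequences $\langle x_n\rangle_{n=1}^\infty$ and $\langle y_n\rangle_{n=1}^\infty$ in $\mathbb{N}$ and $i\in\{1,\ldots,r\}$ such that $$MT(f,\langle x_n\rangle_{n=1}^\infty)\cup MT(g,\langle y_n\rangle_{n=1}^\infty)\subseteq A_i.$$
   Context: $\mathbb{N}$ is the set of positive integers. An $r$-coloring of $\mathbb{N}$ is a partition of $\mathbb{N}$ into $r$ disjoint subsets. For nonempty finite $\beta,\gamma\subseteq\mathbb{N}$, $\beta<\gamma$ means $\max\beta<\min\gamma$. Equivalence of polynomials: for polynomials $f,g:\mathbb{N}^m\to\mathbb{N}$ written $f(x_1,\ldots,x_m)=\sum a_{i_1\cdots i_m}x_1^{i_1}\cdots x_m^{i_m}$ and $g(x_1,\ldots,x_m)=\sum b_{i_1\cdots i_m}x_1^{i_1}\cdots x_m^{i_m}$, one writes $f\approx g$ iff $f$ and $g$ have the same degree and there exists a rational $\alpha\in\mathbb{Q}$ such that $b_{i_1\cdots i_m}=\alpha^{i_1+\cdots+i_m}a_{i_1\cdots i_m}$ for all $(i_1,\ldots,i_m)$. Polynomial Milliken–Taylor system: for a polynomial $f:\mathbb{N}^m\to\mathbb{N}$ with no constant term and a sequence $\langle x_n\rangle_{n=1}^\infty$ in $\mathbb{N}$, $$MT(f,\langle x_n\rangle_{n=1}^\infty)=\left\{f\Bigl(\sum_{i\in\beta_1}x_i,\ldots,\sum_{i\in\beta_m}x_i\Bigr):\beta_1<\cdots<\beta_m\text{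 nonempty finite subsets of }\mathbb{N}\right\}.$$
   Formalization: The rational α in f ≈ g is required to be positive (no restriction if coefficients are nonnegative); with negative α the claim fails, e.g. f = 2x²+x, g = 2x²−x, α = −1, whose value sets on the positive integers are disjoint. *)

theory Defs
  imports Complex_Main "HOL-Library.Poly_Mapping" "HOL-Library.Disjoint_Sets"
begin

text \<open>
  Throughout, the positive integers are the set \<open>{1..}\<close> of type \<^typ>\<open>nat set\<close>; the value of a
  sequence at \<open>0\<close> is never used. A polynomial in the variables \<open>x 1, \<dots>, x m\<close> is a finitely
  supported map from exponent vectors to coefficients. The coefficients are rational, because
  a polynomial with positive integer values on positive integers has rational, but not
  necessarily integral or nonnegative, coefficients.
\<close>

type_synonym mpoly_rat = "(nat \<Rightarrow>\<^sub>0 nat) \<Rightarrow>\<^sub>0 rat"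

definition exp_sum :: "(nat \<Rightarrow>\<^sub>0 nat) \<Rightarrow> nat" where
  "exp_sum e = (\<Sum>i\<in>Poly_Mapping.keys e. Poly_Mapping.lookup e i)"

definition total_degree :: "mpoly_rat \<Rightarrow> nat" where
  "total_degree f = Max (insert 0 (exp_sum ` Poly_Mapping.keys f))"

definition mpoly_eval :: "mpoly_rat \<Rightarrow> (nat \<Rightarrow> nat) \<Rightarrow> rat" where
  "mpoly_eval f x = (\<Sum>e\<in>Poly_Mapping.keys f. Poly_Mapping.lookup f e *
     (\<Prod>i\<in>Poly_Mapping.keys e. of_nat (x i) ^ Poly_Mapping.lookup e i))"

definition pos_valued_poly :: "nat \<Rightarrow> mpoly_rat \<Rightarrow> bool" where
  "pos_valued_poly m f \<longleftrightarrow>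
     (\<forall>e\<in>Poly_Mapping.keys f. Poly_Mapping.keys e \<subseteq> {1..m}) \<and>
     (\<forall>x. (\<forall>i\<in>{1..m}. x i \<in> {1..}) \<longrightarrow> mpoly_eval f x \<in> of_nat ` {1..})"

definition no_constant_term :: "mpoly_rat \<Rightarrow> bool" where
  "no_constant_term f \<longleftrightarrow> Poly_Mapping.lookup f 0 = 0"

text \<open>
  The scaling factor is required to be positive. For polynomials with nonnegative coefficients
  this is no restriction (lemma \<open>poly_equiv_iff_of_nonneg\<close> below). With coefficients of mixed
  signs, a negative factor would relate \<open>2 x\<^sup>2 + x\<close> and \<open>2 x\<^sup>2 - x\<close>, whose values on the
  positive integers are the triangular numbers of positive even index and of odd index,
  respectively. These sets are disjoint, so some 2-coloring separates all values of the one
  polynomial from all values of the other.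
\<close>

definition poly_equiv :: "mpoly_rat \<Rightarrow> mpoly_rat \<Rightarrow> bool"  (infix \<open>\<approx>\<^sub>p\<close> 50) where
  "f \<approx>\<^sub>p g \<longleftrightarrow> total_degree f = total_degree g \<and>
     (\<exists>\<alpha>::rat. \<alpha> > 0 \<and> (\<forall>e. Poly_Mapping.lookup g e = \<alpha> ^ exp_sum e * Poly_Mapping.lookup f e))"

lemma poly_equiv_iff_of_nonneg:
  assumes "\<And>e. Poly_Mapping.lookup f e \<ge> 0" and "\<And>e. Poly_Mapping.lookup g e \<ge> 0"
  shows "f \<approx>\<^sub>p g \<longleftrightarrow> total_degree f = total_degree g \<and>
     (\<exists>\<alpha>::rat. \<forall>e. Poly_Mapping.lookup g e = \<alpha> ^ exp_sum e * Poly_Mapping.lookup f e)"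
proof (intro iffI; (elim conjE exE)?)
  assume "f \<approx>\<^sub>p g"
  then show "total_degree f = total_degree g \<and>
     (\<exists>\<alpha>::rat. \<forall>e. Poly_Mapping.lookup g e = \<alpha> ^ exp_sum e * Poly_Mapping.lookup f e)"
    unfolding poly_equiv_def by blast
next
  fix \<alpha> :: rat
  assume deg: "total_degree f = total_degree g"
    and eq: "\<forall>e. Poly_Mapping.lookup g e = \<alpha> ^ exp_sum e * Poly_Mapping.lookup f e"
  show "f \<approx>\<^sub>p g"
  proof (cases "\<alpha> = 0")
    case True
    have "exp_sum ` Poly_Mapping.keys g \<subseteq> {0}"
      using eq True by (auto simp: in_keys_iff power_0_left split: if_splits)
    then have "insert 0 (exp_sum ` Poly_Mapping.keys g) = {0}" by blast
    then have "total_degree g = 0" unfolding total_degree_def by (simp only: Max_singleton)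
    then have "Max (insert 0 (exp_sum ` Poly_Mapping.keys f)) = 0"
      using deg by (simp add: total_degree_def)
    then have f0: "exp_sum e = 0" if "e \<in> Poly_Mapping.keys f" for e
      using that Max_ge[of "insert 0 (exp_sum ` Poly_Mapping.keys f)" "exp_sum e"] by simp
    have "Poly_Mapping.lookup g e = 1 ^ exp_sum e * Poly_Mapping.lookup f e" for e
      using eq[rule_format, of e] f0[of e]
      by (cases "e \<in> Poly_Mapping.keys f") (auto simp: in_keys_iff)
    then show ?thesis
      unfolding poly_equiv_def using deg by (intro conjI exI[of _ 1]) auto
  next
    case False
    have "Poly_Mapping.lookup g e = \<bar>\<alpha>\<bar> ^ exp_sum e * Poly_Mapping.lookup f e" for e
    proof -
      have "Poly_Mapping.lookup g e = \<bar>Poly_Mapping.lookup g e\<bar>" using assms(2) by simp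
      also have "\<dots> = \<bar>\<alpha>\<bar> ^ exp_sum e * \<bar>Poly_Mapping.lookup f e\<bar>"
        using eq by (simp add: abs_mult power_abs)
      finally show ?thesis using assms(1) by simp
    qed
    then show ?thesis
      unfolding poly_equiv_def using deg False by (intro conjI exI[of _ "\<bar>\<alpha>\<bar>"]) auto
  qed
qed

definition MT :: "nat \<Rightarrow> mpoly_rat \<Rightarrow> (nat \<Rightarrow> nat) \<Rightarrow> rat set" where
  "MT m f x = {mpoly_eval f (\<lambda>j. \<Sum>i\<in>\<beta> j. x i) | \<beta> :: nat \<Rightarrow> nat set.
     (\<forall>j\<in>{1..m}. finite (\<beta> j) \<and> \<beta> j \<noteq> {} \<and> \<beta> j \<subseteq> {1..}) \<and>
     (\<forall>j\<in>{1..<m}. Max (\<beta> j) < Min (\<beta> (Suc j)))}"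

definition coloring :: "nat \<Rightarrow> (nat \<Rightarrow> nat set) \<Rightarrow> bool" where
  "coloring r A \<longleftrightarrow> (\<Union>i\<in>{1..r}. A i) = {1..} \<and> disjoint_family_on A {1..r}"

end

theory Submission
  imports Defs
begin

text \<open>
  If \<open>g\<close> arises from \<open>f\<close> with the factor \<open>\<alpha> = a / b\<close>, then \<open>g (b s) = f (a s)\<close> for every
  \<open>m\<close>-tuple \<open>s\<close>. So it suffices to find one sequence \<open>z\<close> such that all values of
  \<open>f\<close> on \<open>MT\<close>-tuples of \<open>a z\<close> have the same colour, and to take \<open>x = a z\<close> and \<open>y = b z\<close>. Such a
  sequence exists by the Milliken--Taylor theorem. That theorem follows from the existence of an
  idempotent ultrafilter \<open>p\<close> on the positive integers: the colour is the iterated \<open>p\<close>-limit of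
  the colours of the \<open>m\<close>-tuples, and \<open>z\<close> is built greedily as in the Galvin--Glazer proof of
  Hindman's theorem. The idempotent comes from the Ellis--Numakura argument, with
  closed subsemigroups replaced by filters \<open>F\<close> satisfying \<open>F + F \<le> F\<close>.
\<close>

section \<open>Idempotent ultrafilters\<close>

definition ultra :: "'a filter \<Rightarrow> bool" where
  "ultra p \<longleftrightarrow> p \<noteq> bot \<and> (\<forall>P. eventually P p \<or> eventually (\<lambda>x. \<not> P x) p)"

lemma ultra_not_eventually:
  assumes "ultra p" and "\<not> eventually P p"
  shows "eventually (\<lambda>x. \<not> P x) p"
  using assms unfolding ultra_def by blast

lemma ultra_eventually_bex:
  assumes "ultra p" and "finite I" and "eventually (\<lambda>x. \<exists>i\<in>I. P i x) p"
  shows "\<exists>i\<in>I. eventually (P i) p"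
proof (rule ccontr)
  assume "\<not> ?thesis"
  then have "\<forall>i\<in>I. eventually (\<lambda>x. \<not> P i x) p"
    using ultra_not_eventually[OF assms(1)] by blast
  then have "eventually (\<lambda>x. \<forall>i\<in>I. \<not> P i x) p"
    using assms(2) by (simp add: eventually_ball_finite)
  with assms(3) have "eventually (\<lambda>x. False) p"
    by eventually_elim blast
  with assms(1) show False by (simp add: ultra_def eventually_False)
qed

text \<open>A chain is directed downwards, so an event of its infimum already occurs in one member.
  This takes the place of compactness of the space of ultrafilters.\<close>

lemma Inf_chain_neq_bot:
  fixes C :: "'a filter set"
  assumes "C \<noteq> {}" and "\<And>F. F \<in> C \<Longrightarrow> F \<noteq> bot"
    and chain: "\<And>F G. F \<in> C \<Longrightarrow> G \<in> C \<Longrightarrow> F \<le> G \<or> G \<le> F"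
  shows "Inf C \<noteq> bot"
proof -
  have "eventually (\<lambda>x. False) (Inf C) \<longleftrightarrow> (\<exists>F\<in>C. eventually (\<lambda>x. False) F)"
  proof (rule eventually_Inf_base[OF assms(1)])
    fix F G assume "F \<in> C" "G \<in> C"
    with chain[OF this] show "\<exists>x\<in>C. x \<le> inf F G"
      by (metis inf.absorb1 inf.absorb2 order_refl)
  qed
  with assms(2) show ?thesis unfolding trivial_limit_def by blast
qed

text \<open>Zorn's lemma for the reversed order. The chain condition concerns nonempty chains only,
  so \<open>F0\<close> serves as the bound of the empty chain.\<close>

lemma minimal_filter_exists:
  fixes Q :: "'a filter \<Rightarrow> bool"
  assumes "Q F0"
    and chain: "\<And>C. C \<noteq> {} \<Longrightarrow> (\<And>F. F \<in> C \<Longrightarrow> Q F) \<Longrightarrow>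
      (\<And>F G. F \<in> C \<Longrightarrow> G \<in> C \<Longrightarrow> F \<le> G \<or> G \<le> F) \<Longrightarrow> Q (Inf C)"
  shows "\<exists>F. Q F \<and> (\<forall>G. Q G \<longrightarrow> G \<le> F \<longrightarrow> G = F)"
proof -
  have "\<exists>m\<in>Collect Q. \<forall>a\<in>Collect Q. m \<ge> a \<longrightarrow> a = m"
  proof (rule predicate_Zorn)
    show "partial_order_on (Collect Q) (relation_of (\<ge>) (Collect Q))"
      by (rule partial_order_on_relation_ofI) auto
  next
    fix C assume "C \<in> Chains (relation_of (\<ge>) (Collect Q))"
    then have C: "\<And>F. F \<in> C \<Longrightarrow> Q F" "\<And>F G. F \<in> C \<Longrightarrow> G \<in> C \<Longrightarrow> F \<le> G \<or> G \<le> F"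
      by (auto simp: Chains_def relation_of_def)
    show "\<exists>u\<in>Collect Q. \<forall>a\<in>C. a \<ge> u"
    proof (cases "C = {}")
      case True
      with assms(1) show ?thesis by auto
    next
      case False
      from chain[OF this C] have "Q (Inf C)" by blast
      then show ?thesis by (auto intro: Inf_lower)
    qed
  qed
  then show ?thesis by auto
qed

text \<open>A minimal proper filter \<open>p\<close> below \<open>F\<close> is an ultrafilter:
  unless the complement of \<open>P\<close> is in \<open>p\<close>, adjoining \<open>P\<close> keeps
  \<open>p\<close> proper, so by minimality \<open>P\<close> was in \<open>p\<close>
  already.\<close>

lemma ultra_exists:
  assumes "F \<noteq> bot"
  obtains p where "ultra p" and "p \<le> F"
proof -
  define Q where "Q G \<longleftrightarrow> G \<noteq> bot \<and> G \<le> F" for G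
  have "Q F" using assms by (simp add: Q_def)
  then have "\<exists>p. Q p \<and> (\<forall>G. Q G \<longrightarrow> G \<le> p \<longrightarrow> G = p)"
  proof (rule minimal_filter_exists[of Q])
    fix C assume C: "C \<noteq> {}" "\<And>F. F \<in> C \<Longrightarrow> Q F"
      "\<And>F G. F \<in> C \<Longrightarrow> G \<in> C \<Longrightarrow> F \<le> G \<or> G \<le> F"
    have "Inf C \<noteq> bot"
      using C by (intro Inf_chain_neq_bot) (auto simp: Q_def)
    moreover have "Inf C \<le> F"
      using C(1,2) by (auto simp: Q_def intro: Inf_lower2)
    ultimately show "Q (Inf C)" by (simp add: Q_def)
  qed
  then obtain p where p: "Q p" "\<And>G. Q G \<Longrightarrow> G \<le> p \<Longrightarrow> G = p" by blast
  have "eventually P p \<or> eventually (\<lambda>x. \<not> P x) p" for P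
  proof (rule disjCI)
    assume "\<not> eventually (\<lambda>x. \<not> P x) p"
    then have "inf p (principal (Collect P)) \<noteq> bot"
      by (simp add: trivial_limit_def eventually_inf_principal)
    then have "inf p (principal (Collect P)) = p"
      using p(1) by (intro p(2)) (auto simp: Q_def intro: le_infI1)
    moreover have "eventually P (inf p (principal (Collect P)))"
      by (simp add: eventually_inf_principal)
    ultimately show "eventually P p" by simp
  qed
  with p(1) show thesis by (intro that[of p]) (auto simp: ultra_def Q_def)
qed

section \<open>Sums of filters, extending the addition of ultrafilters in the Stone-Cech
  compactification\<close>

definition add_filter :: "'a::semigroup_add filter \<Rightarrow> 'a filter \<Rightarrow> 'a filter" where
  "add_filter F G = Abs_filter (\<lambda>P. \<forall>\<^sub>F n in F. \<forall>\<^sub>F k in G. P (n + k))"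

lemma eventually_add_filter:
  "eventually P (add_filter F G) \<longleftrightarrow> (\<forall>\<^sub>F n in F. \<forall>\<^sub>F k in G. P (n + k))"
  unfolding add_filter_def
proof (rule eventually_Abs_filter, rule is_filter.intro)
  show "\<forall>\<^sub>F n in F. \<forall>\<^sub>F k in G. P (n + k) \<and> Q (n + k)"
    if "\<forall>\<^sub>F n in F. \<forall>\<^sub>F k in G. P (n + k)" "\<forall>\<^sub>F n in F. \<forall>\<^sub>F k in G. Q (n + k)" for P Q
    using that by eventually_elim (rule eventually_conj)
  show "\<forall>\<^sub>F n in F. \<forall>\<^sub>F k in G. Q (n + k)"
    if "\<forall>x. P x \<longrightarrow> Q x" "\<forall>\<^sub>F n in F. \<forall>\<^sub>F k in G. P (n + k)" for P Q
    using that(2) by eventually_elim (use that(1) in \<open>auto elim: eventually_mono\<close>)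
qed simp

lemma add_filter_assoc: "add_filter (add_filter F G) H = add_filter F (add_filter G H)"
  by (simp add: filter_eq_iff eventually_add_filter add.assoc)

lemma add_filter_mono:
  assumes "F \<le> F'" and "G \<le> G'"
  shows "add_filter F G \<le> add_filter F' G'"
proof (rule filter_leI)
  fix P assume "eventually P (add_filter F' G')"
  then have "\<forall>\<^sub>F n in F. \<forall>\<^sub>F k in G'. P (n + k)"
    unfolding eventually_add_filter using assms(1) by (rule filter_leD[rotated])
  then show "eventually P (add_filter F G)"
    unfolding eventually_add_filter
    by eventually_elim (rule filter_leD[OF assms(2)])
qed

lemma add_filter_eq_bot_iff: "add_filter F G = bot \<longleftrightarrow> F = bot \<or> G = bot"
proof -
  have "add_filter F G = bot \<longleftrightarrow> (\<forall>\<^sub>F n in F. \<forall>\<^sub>F k in G. False)"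
    by (simp only: trivial_limit_def eventually_add_filter)
  then show ?thesis by (auto simp: eventually_const_iff)
qed

text \<open>A filter stands for the closed set of ultrafilters below it. A minimal \<open>F\<close>
  with \<open>F + F \<le> F\<close> plays the role of a minimal closed subsemigroup, and any
  ultrafilter \<open>p\<close> below it turns out to be idempotent.\<close>

lemma idempotent_ultrafilter_exists:
  fixes F0 :: "'a::semigroup_add filter"
  assumes "F0 \<noteq> bot" and "add_filter F0 F0 \<le> F0"
  obtains p where "ultra p" and "p \<le> F0" and "add_filter p p \<le> p"
proof -
  define Q where "Q F \<longleftrightarrow> F \<noteq> bot \<and> F \<le> F0 \<and> add_filter F F \<le> F" for F
  have "Q F0" using assms by (simp add: Q_def)
  then have "\<exists>F. Q F \<and> (\<forall>G. Q G \<longrightarrow> G \<le> F \<longrightarrow> G = F)"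
  proof (rule minimal_filter_exists[of Q])
    fix C assume C: "C \<noteq> {}" "\<And>F. F \<in> C \<Longrightarrow> Q F"
      "\<And>F G. F \<in> C \<Longrightarrow> G \<in> C \<Longrightarrow> F \<le> G \<or> G \<le> F"
    have "Inf C \<noteq> bot"
      using C by (intro Inf_chain_neq_bot) (auto simp: Q_def)
    moreover have "Inf C \<le> F0"
      using C(1,2) by (auto simp: Q_def intro: Inf_lower2)
    moreover have "add_filter (Inf C) (Inf C) \<le> Inf C"
    proof (rule Inf_greatest)
      fix F assume "F \<in> C"
      then have "add_filter (Inf C) (Inf C) \<le> add_filter F F"
        by (intro add_filter_mono Inf_lower)
      also have "\<dots> \<le> F" using C(2)[OF \<open>F \<in> C\<close>] by (simp add: Q_def)
      finally show "add_filter (Inf C) (Inf C) \<le> F" .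
    qed
    ultimately show "Q (Inf C)" by (simp add: Q_def)
  qed
  then obtain F where F: "Q F" and min: "\<And>G. Q G \<Longrightarrow> G \<le> F \<Longrightarrow> G = F" by blast
  from F have F': "F \<noteq> bot" "F \<le> F0" "add_filter F F \<le> F" by (auto simp: Q_def)
  obtain p where p: "ultra p" "p \<le> F" using ultra_exists[OF F'(1)] .
  have "p \<noteq> bot" using p(1) by (simp add: ultra_def)

  \<comment> \<open>The left ideal \<open>F + p\<close> is again a subsemigroup inside
    \<open>F\<close>, so minimality forces equality.\<close>
  have Fp: "add_filter F p = F"
  proof (rule min)
    show le: "add_filter F p \<le> F"
      using add_filter_mono[OF order_refl p(2)] F'(3) by (rule order_trans)
    have "add_filter (add_filter F p) (add_filter F p) \<le> add_filter F (add_filter F p)"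
      using le by (intro add_filter_mono) auto
    also have "\<dots> = add_filter (add_filter F F) p" by (simp add: add_filter_assoc)
    also have "\<dots> \<le> add_filter F p" using F'(3) by (intro add_filter_mono) auto
    finally show "Q (add_filter F p)"
      using F'(1,2) \<open>p \<noteq> bot\<close> le by (auto simp: Q_def add_filter_eq_bot_iff)
  qed

  \<comment> \<open>\<open>H\<close> is the coarsest filter below \<open>F\<close> with \<open>H + p \<le> p\<close>.\<close>
  define B where "B C = {n. \<forall>\<^sub>F k in p. C (n + k)}" for C
  define H where "H = inf F (INF C\<in>{C. eventually C p}. principal (B C))"
  \<comment> \<open>The sets \<open>B C\<close> form a directed family, since \<open>B\<close> of a
    conjunction lies in both sets; hence a single \<open>C\<close> suffices.\<close>
  have evH: "eventually P H \<longleftrightarrow>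
      (\<exists>C. eventually C p \<and> (\<forall>\<^sub>F n in F. n \<in> B C \<longrightarrow> P n))" for P
  proof -
    have "H = (INF C\<in>{C. eventually C p}. inf F (principal (B C)))"
      unfolding H_def by (rule INF_inf_const1[symmetric]) (auto intro: exI[of _ "\<lambda>_. True"])
    moreover have "eventually P (INF C\<in>{C. eventually C p}. inf F (principal (B C))) \<longleftrightarrow>
        (\<exists>C\<in>{C. eventually C p}. eventually P (inf F (principal (B C))))"
    proof (rule eventually_INF_base)
      show "{C. eventually C p} \<noteq> {}" by (auto intro: exI[of _ "\<lambda>_. True"])
      fix C D assume *: "C \<in> {C. eventually C p}" "D \<in> {C. eventually C p}"
      have "B (\<lambda>x. C x \<and> D x) \<subseteq> B C \<inter> B D"
        by (auto simp: B_def elim: eventually_mono)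
      then have "inf F (principal (B (\<lambda>x. C x \<and> D x)))
          \<le> inf (inf F (principal (B C))) (inf F (principal (B D)))"
        by (intro le_infI inf_mono) auto
      with * show "\<exists>x\<in>{C. eventually C p}. inf F (principal (B x))
          \<le> inf (inf F (principal (B C))) (inf F (principal (B D)))"
        by (intro bexI[of _ "\<lambda>x. C x \<and> D x"]) (auto intro: eventually_conj)
    qed
    ultimately show ?thesis by (auto simp: eventually_inf_principal)
  qed
  have "H = F"
  proof (rule min)
    show "H \<le> F" by (simp add: H_def)
    \<comment> \<open>Some element of \<open>F\<close> should solve \<open>q + p = p\<close>,
      because \<open>F + p = F\<close> lies above \<open>p\<close>. In terms of filters: if
      \<open>F\<close>-almost all \<open>n\<close> missed \<open>B C\<close>, then, \<open>p\<close>
      being ultra, the negation of \<open>C\<close> would hold along \<open>F + p = F\<close>, hence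
      along \<open>p\<close>.\<close>
    have "H \<noteq> bot"
    proof
      assume "H = bot"
      then obtain C where C: "eventually C p" "\<forall>\<^sub>F n in F. n \<notin> B C"
        using evH[of "\<lambda>_. False"] by auto
      from C(2) have "\<forall>\<^sub>F n in F. \<forall>\<^sub>F k in p. \<not> C (n + k)"
        by eventually_elim (auto simp: B_def intro: ultra_not_eventually[OF p(1)])
      then have "eventually (\<lambda>n. \<not> C n) (add_filter F p)"
        by (simp add: eventually_add_filter)
      then have "eventually (\<lambda>n. \<not> C n) p"
        using p(2) unfolding Fp by (rule filter_leD[rotated])
      with C(1) have "eventually (\<lambda>n. False) p" by eventually_elim simp
      with \<open>p \<noteq> bot\<close> show False by (simp add: eventually_False)
    qed
    moreover have "add_filter H H \<le> H"
    proof -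
      have "add_filter H H \<le> add_filter F F"
        by (rule add_filter_mono[OF \<open>H \<le> F\<close> \<open>H \<le> F\<close>])
      then have "add_filter H H \<le> F" using F'(3) by (rule order_trans)
      moreover have "add_filter H H \<le> principal (B C)" if C: "eventually C p" for C
      proof -
        have H_B: "\<forall>\<^sub>F n in H. n \<in> B D" if "eventually D p" for D
          unfolding evH using that by (intro exI[of _ D]) simp
        \<comment> \<open>For \<open>n\<close> in \<open>B C\<close> the shifted predicate
          \<open>C (n + k)\<close> is itself \<open>p\<close>-large, so \<open>H_B\<close> applies
          to it a second time.\<close>
        have "\<forall>\<^sub>F n in H. \<forall>\<^sub>F k in H. n + k \<in> B C"
          using H_B[OF C]
        proof eventually_elim
          case (elim n)
          then have "\<forall>\<^sub>F k in p. C (n + k)" by (simp add: B_def)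
          from H_B[OF this] show ?case by (simp add: B_def add.assoc)
        qed
        then show ?thesis by (simp add: le_principal eventually_add_filter)
      qed
      ultimately show ?thesis
        unfolding H_def by (intro le_infI INF_greatest) auto
    qed
    ultimately show "Q H" using \<open>H \<le> F\<close> F'(2) by (auto simp: Q_def)
  qed
  have "add_filter p p \<le> p"
  proof (rule filter_leI)
    fix C assume "eventually C p"
    then have "\<forall>\<^sub>F n in H. n \<in> B C" unfolding evH by (intro exI[of _ C]) simp
    then have "\<forall>\<^sub>F n in p. n \<in> B C" using p(2) unfolding \<open>H = F\<close> by (rule filter_leD[rotated])
    then show "eventually C (add_filter p p)" by (simp add: eventually_add_filter B_def)
  qed
  with p F'(2) show thesis by (auto intro: that)
qed

section \<open>The Milliken--Taylor theorem\<close>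

text \<open>Lists are extended at the front, so they list the entries of a tuple in reverse order.\<close>

primrec iter_eventually :: "'a filter \<Rightarrow> nat \<Rightarrow> ('a list \<Rightarrow> bool) \<Rightarrow> 'a list \<Rightarrow> bool" where
  "iter_eventually p 0 P l = P l"
| "iter_eventually p (Suc k) P l = (\<forall>\<^sub>F n in p. iter_eventually p k P (n # l))"

lemma iter_eventuallyI:
  assumes "eventually Q p"
    and "\<And>l'. length l' = k \<Longrightarrow> list_all Q l' \<Longrightarrow> P (l' @ l)"
  shows "iter_eventually p k P l"
  using assms(2)
proof (induction k arbitrary: l)
  case (Suc k)
  have "iter_eventually p k P (n # l)" if "Q n" for n
    by (rule Suc.IH) (use that Suc.prems[of "l' @ [n]" for l'] in auto)
  then show ?case using assms(1) by (auto elim: eventually_mono)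
qed simp

text \<open>An ultrafilter selects one of finitely many alternatives, so the choice of a colour
  moves outwards through the \<open>k\<close> quantifiers one at a time.\<close>

lemma iter_eventually_bex:
  assumes "ultra p" and "finite I" and "iter_eventually p k (\<lambda>l. \<exists>i\<in>I. P i l) l"
  shows "\<exists>i\<in>I. iter_eventually p k (P i) l"
  using assms(3)
proof (induction k arbitrary: l)
  case (Suc k)
  then have "\<forall>\<^sub>F n in p. \<exists>i\<in>I. iter_eventually p k (P i) (n # l)"
    by (auto elim: eventually_mono)
  from ultra_eventually_bex[OF assms(1,2) this] show ?case by simp
qed simp

text \<open>The clause for \<open>n + k\<close> makes goodness stable under adding a \<open>p\<close>-large set of numbers to
  the newest entry.\<close>

primrec good :: "'a::plus filter \<Rightarrow> ('a list \<Rightarrow> bool) \<Rightarrow> 'a list \<Rightarrow> bool" where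
  "good p Q [] = Q []"
| "good p Q (n # l) = (good p Q l \<and> Q (n # l) \<and> (\<forall>\<^sub>F k in p. Q ((n + k) # l)))"

lemma good_imp: "good p Q l \<Longrightarrow> Q l"
  by (cases l) auto

text \<open>Idempotence replaces a \<open>p\<close>-large set of \<open>n\<close> by the
  \<open>p\<close>-large set of those \<open>n\<close> for which \<open>n + k\<close> stays in it
  for \<open>p\<close>-almost all \<open>k\<close>.\<close>

lemma eventually_good_Cons:
  assumes "add_filter p p \<le> p" and "good p Q l" and "\<forall>\<^sub>F n in p. Q (n # l)"
  shows "\<forall>\<^sub>F n in p. good p Q (n # l)"
proof -
  have "\<forall>\<^sub>F n in p. \<forall>\<^sub>F k in p. Q ((n + k) # l)"
    using filter_leD[OF assms(1,3)] by (simp add: eventually_add_filter)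
  with assms(3) show ?thesis by eventually_elim (use assms(2) in simp)
qed

text \<open>Idempotence is applied to the \<open>p\<close>-large set of admissible increments
  \<open>k\<close>; associativity turns its conclusion into the stability clause for
  \<open>n + k\<close>.\<close>

lemma eventually_good_add:
  fixes p :: "'a::semigroup_add filter"
  assumes "add_filter p p \<le> p" and "good p Q (n # l)"
  shows "\<forall>\<^sub>F k in p. good p Q ((n + k) # l)"
proof -
  have *: "\<forall>\<^sub>F k in p. Q ((n + k) # l)" using assms(2) by simp
  have "\<forall>\<^sub>F k in p. \<forall>\<^sub>F j in p. Q ((n + (k + j)) # l)"
    using filter_leD[OF assms(1) *] by (simp add: eventually_add_filter)
  with * show ?thesis by eventually_elim (use assms(2) in \<open>simp add: add.assoc\<close>)
qed

text \<open>Comparing elements of all pairs of blocks, instead of \<open>Max\<close> and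
  \<open>Min\<close> of neighbours, makes the order condition pass directly to smaller blocks and to
  initial segments of the block sequence.\<close>

definition increasing_blocks :: "nat \<Rightarrow> (nat \<Rightarrow> nat set) \<Rightarrow> bool" where
  "increasing_blocks m \<beta> \<longleftrightarrow>
     (\<forall>j\<in>{1..m}. finite (\<beta> j) \<and> \<beta> j \<noteq> {} \<and> \<beta> j \<subseteq> {1..}) \<and>
     (\<forall>i\<in>{1..m}. \<forall>j\<in>{1..m}. i < j \<longrightarrow> (\<forall>a\<in>\<beta> i. \<forall>b\<in>\<beta> j. a < b))"

text \<open>The passage from neighbours to arbitrary pairs uses that the blocks in between are
  nonempty: each supplies an intermediate element.\<close>

lemma increasing_blocksI:
  assumes fin: "\<forall>j\<in>{1..m}. finite (\<beta> j) \<and> \<beta> j \<noteq> {} \<and> \<beta> j \<subseteq> {1..}"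
    and less: "\<forall>j\<in>{1..<m}. Max (\<beta> j) < Min (\<beta> (Suc j))"
  shows "increasing_blocks m \<beta>"
proof -
  have step: "a < b" if "j \<in> {1..<m}" "a \<in> \<beta> j" "b \<in> \<beta> (Suc j)" for j a b
  proof -
    have "finite (\<beta> j)" "finite (\<beta> (Suc j))" using fin that(1) by simp_all
    then have "a \<le> Max (\<beta> j)" "Min (\<beta> (Suc j)) \<le> b" using that(2,3) by simp_all
    with bspec[OF less that(1)] show ?thesis by linarith
  qed
  have "a < b" if "1 \<le> i" "i < j" "j \<le> m" "a \<in> \<beta> i" "b \<in> \<beta> j" for i j a b
    using that(2,3,5)
  proof (induction j arbitrary: b)
    case (Suc j)
    show ?case
    proof (cases "i = j")
      case True
      with Suc.prems that(1,4) show ?thesis by (intro step[of i]) auto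
    next
      case False
      with Suc.prems have "i < j" "j \<in> {1..<m}" by auto
      moreover from this fin obtain c where c: "c \<in> \<beta> j" by fastforce
      ultimately have "a < c" using Suc.IH Suc.prems by auto
      also have "c < b" using step[OF \<open>j \<in> {1..<m}\<close> c Suc.prems(3)] .
      finally show ?thesis .
    qed
  qed simp
  with fin show ?thesis unfolding increasing_blocks_def by auto
qed

theorem Milliken_Taylor:
  fixes C :: "'i \<Rightarrow> nat list \<Rightarrow> bool"
  assumes "finite I"
    and colour: "\<And>l. length l = m \<Longrightarrow> \<forall>n\<in>set l. n \<ge> 1 \<Longrightarrow> \<exists>i\<in>I. C i l"
  obtains i z where "i \<in> I" and "\<And>n. z n \<ge> 1"
    and "\<And>\<beta>. increasing_blocks m \<beta> \<Longrightarrow> C i (map (\<lambda>j. \<Sum>n\<in>\<beta> j. z n) [1..<Suc m])"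
proof -
  \<comment> \<open>Starting from \<open>at_top\<close> excludes the idempotent ultrafilter
    concentrated at 0 and makes \<open>p\<close>-almost all numbers positive.\<close>
  have "add_filter at_top at_top \<le> (at_top :: nat filter)"
  proof (rule filter_leI)
    fix P :: "nat \<Rightarrow> bool" assume "eventually P at_top"
    then obtain N where "\<And>n. n \<ge> N \<Longrightarrow> P n" by (auto simp: eventually_at_top_linorder)
    then have "\<forall>\<^sub>F k in at_top. P (n + k)" for n
      by (auto simp: eventually_at_top_linorder intro!: exI[of _ N])
    then show "eventually P (add_filter at_top at_top)" by (simp add: eventually_add_filter)
  qed
  then obtain p :: "nat filter" where p: "ultra p" "p \<le> at_top" "add_filter p p \<le> p"
    using idempotent_ultrafilter_exists[of "at_top :: nat filter"] by auto
  have p_nonempty: "\<exists>n. P n" if "eventually P p" for P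
    using p(1) that by (auto simp: ultra_def dest: eventually_happens)
  have p_ge: "\<forall>\<^sub>F n in p. n \<ge> 1" using p(2) eventually_ge_at_top by (rule filter_leD)

  have "iter_eventually p m (\<lambda>l. \<exists>i\<in>I. C i (rev l)) []"
    by (rule iter_eventuallyI[OF p_ge]) (auto simp: list_all_iff intro!: colour)
  from iter_eventually_bex[OF p(1) assms(1) this]
  obtain i where i: "i \<in> I" "iter_eventually p m (\<lambda>l. C i (rev l)) []" ..
  \<comment> \<open>\<open>Q l\<close> says that the partial tuple \<open>l\<close> still has limit
    colour \<open>i\<close> when the missing entries are chosen along \<open>p\<close>. At length
    \<open>m\<close> it is the colour condition itself.\<close>
  define Q where "Q l = iter_eventually p (m - length l) (\<lambda>l. C i (rev l)) l" for l
  have Q_Nil: "good p Q []" using i(2) by (simp add: Q_def)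
  have Q_Cons: "\<forall>\<^sub>F n in p. good p Q (n # l)" if "good p Q l" "length l < m" for l
  proof (rule eventually_good_Cons[OF p(3) that(1)])
    have "m - length l = Suc (m - Suc (length l))" using that(2) by simp
    with good_imp[OF that(1)] show "\<forall>\<^sub>F n in p. Q (n # l)" by (simp add: Q_def)
  qed

  \<comment> \<open>A new term \<open>z\<close> is left out, opens a new newest block, or joins the
    newest block. Older blocks are closed to it because its index is the largest so far.\<close>
  define step where "step S z = S \<union> (\<lambda>l. z # l) ` {l\<in>S. length l < m}
      \<union> (\<lambda>l. (hd l + z) # tl l) ` (S - {[]})" for S and z :: nat
  have step_add: "(n + z) # l \<in> step S z" if "n # l \<in> S" for n l S z
    unfolding step_def using that by (intro UnI2 image_eqI[of _ _ "n # l"]) auto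
  define Inv where "Inv S \<longleftrightarrow> finite S \<and> (\<forall>l\<in>S. good p Q l \<and> length l \<le> m)" for S
  \<comment> \<open>Each stage is finite, so only finitely many \<open>p\<close>-large conditions
    restrict the next term, and a common solution exists.\<close>
  have "\<exists>S :: nat \<Rightarrow> nat list set. \<forall>n. (Inv (S n) \<and> (n = 0 \<longrightarrow> S n = {[]})) \<and>
      (\<exists>z\<ge>1. S (Suc n) = step (S n) z)"
  proof (rule dependent_nat_choice)
    show "\<exists>S. Inv S \<and> (0 = (0::nat) \<longrightarrow> S = {[]})"
      using Q_Nil by (auto simp: Inv_def)
  next
    fix S and n :: nat assume "Inv S \<and> (n = 0 \<longrightarrow> S = {[]})"
    then have S: "finite S" "\<And>l. l \<in> S \<Longrightarrow> good p Q l" "\<And>l. l \<in> S \<Longrightarrow> length l \<le> m"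
      by (auto simp: Inv_def)
    have "\<forall>\<^sub>F z in p. \<forall>l\<in>{l\<in>S. length l < m}. good p Q (z # l)"
      using S Q_Cons by (intro eventually_ball_finite) auto
    moreover have "\<forall>\<^sub>F z in p. \<forall>l\<in>S - {[]}. good p Q ((hd l + z) # tl l)"
    proof (intro eventually_ball_finite ballI)
      fix l assume "l \<in> S - {[]}"
      with S(2)[of l] show "\<forall>\<^sub>F z in p. good p Q ((hd l + z) # tl l)"
        by (intro eventually_good_add[OF p(3)]) auto
    qed (use S in auto)
    ultimately have "\<forall>\<^sub>F z in p. z \<ge> 1 \<and> Inv (step S z)"
      using p_ge
    proof eventually_elim
      case (elim z)
      with S show ?case by (fastforce simp: Inv_def step_def)
    qed
    then obtain z where "z \<ge> 1" "Inv (step S z)" using p_nonempty by blast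
    then show "\<exists>S'. (Inv S' \<and> (Suc n = 0 \<longrightarrow> S' = {[]})) \<and> (\<exists>z\<ge>1. S' = step S z)" by blast
  qed
  then obtain S where S: "\<And>n. Inv (S n)" "S 0 = {[]}"
    and "\<forall>n. \<exists>z\<ge>1. S (Suc n) = step (S n) z" by auto
  then obtain z' where z': "\<And>n. z' n \<ge> 1" "\<And>n. S (Suc n) = step (S n) (z' n)" by metis
  \<comment> \<open>The term added in passing from stage \<open>N\<close> to \<open>Suc N\<close>
    gets the index \<open>Suc N\<close>, since blocks contain positive indices only.\<close>
  define z where "z n = z' (n - 1)" for n

  define bsums where "bsums \<beta> k = map (\<lambda>j. \<Sum>n\<in>\<beta> j. z n) (rev [1..<Suc k])" for \<beta> k
  have bsums_Suc: "bsums \<beta> (Suc k) = (\<Sum>n\<in>\<beta> (Suc k). z n) # bsums \<beta> k" for \<beta> k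
    by (simp add: bsums_def)
  have bsums_cong: "bsums \<beta> k = bsums \<beta>' k" if "\<And>j. j \<in> {1..k} \<Longrightarrow> \<beta> j = \<beta>' j" for \<beta> \<beta>' k
    unfolding bsums_def using that by (intro map_cong) auto
  \<comment> \<open>Stage \<open>N\<close> has recorded every tuple of block sums with indices up to
    \<open>N\<close>; the shorter tuples are needed for the induction.\<close>
  have bsums_in: "bsums \<beta> k \<in> S N"
    if "increasing_blocks k \<beta>" "k \<le> m" "\<And>j. j \<in> {1..k} \<Longrightarrow> \<beta> j \<subseteq> {1..N}" for \<beta> k N
    using that
  proof (induction N arbitrary: \<beta> k)
    case 0
    have "k = 0"
    proof (rule ccontr)
      assume "k \<noteq> 0"
      then have "1 \<in> {1..k}" by simp
      with 0 show False by (fastforce simp: increasing_blocks_def)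
    qed
    then show ?case by (simp add: bsums_def S(2))
  next
    case (Suc N)
    have block: "finite (\<beta> j)" "\<beta> j \<noteq> {}" "\<beta> j \<subseteq> {1..Suc N}" if "j \<in> {1..k}" for j
      using Suc.prems(1,3) that unfolding increasing_blocks_def by blast+
    have less: "a < b" if "i \<in> {1..k}" "j \<in> {1..k}" "i < j" "a \<in> \<beta> i" "b \<in> \<beta> j" for i j a b
      using Suc.prems(1) that unfolding increasing_blocks_def by blast
    have sub: "S N \<subseteq> S (Suc N)" by (auto simp: z'(2) step_def)
    \<comment> \<open>The largest index \<open>Suc N\<close> can only occur in the last block. It is
      absent, is the whole block, or is added to earlier indices: these are the three parts of
      \<open>step\<close>.\<close>
    show ?case
    proof (cases "k = 0 \<or> Suc N \<notin> \<beta> k")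
      case True
      have "\<beta> j \<subseteq> {1..N}" if j: "j \<in> {1..k}" for j
      proof -
        have "Suc N \<notin> \<beta> j"
        proof
          assume *: "Suc N \<in> \<beta> j"
          with True j have "j < k" by (cases "j = k") auto
          moreover have k: "k \<in> {1..k}" using j by simp
          moreover obtain b where b: "b \<in> \<beta> k" using block(2)[OF k] by blast
          ultimately have "Suc N < b" using less[OF j k _ *] by blast
          moreover have "b \<in> {1..Suc N}" using block(3)[OF k] b by blast
          ultimately show False by simp
        qed
        with block(3)[OF j] show ?thesis by (auto simp: atLeastAtMostSuc_conv)
      qed
      with Suc.IH[OF Suc.prems(1,2)] sub show ?thesis by blast
    next
      case False
      then obtain k' where k: "k = Suc k'" and mem: "Suc N \<in> \<beta> (Suc k')" by (cases k) auto
      define D where "D = \<beta> k - {Suc N}"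
      have "k \<in> {1..k}" by (simp add: k)
      note block_k = block[OF this]
      have fin: "finite D" and ins: "\<beta> k = insert (Suc N) D"
        using block_k(1) mem by (auto simp: D_def k)
      have Dsub: "D \<subseteq> {1..N}"
        using block_k(3) by (auto simp: D_def atLeastAtMostSuc_conv)
      have sumD: "(\<Sum>n\<in>\<beta> k. z n) = (\<Sum>n\<in>D. z n) + z' N"
      proof -
        have "Suc N \<notin> D" by (simp add: D_def)
        then show ?thesis unfolding ins using fin by (simp add: z_def)
      qed
      have old: "\<beta> j \<subseteq> {1..N}" if j: "j \<in> {1..k'}" for j
      proof
        fix a assume a: "a \<in> \<beta> j"
        have "a < Suc N" using j k by (intro less[OF _ _ _ a mem]) auto
        moreover have "a \<ge> 1" using block(3)[of j] a j k by auto
        ultimately show "a \<in> {1..N}" by simp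
      qed
      show ?thesis
      proof (cases "D = {}")
        case True
        have "{1..k'} \<subseteq> {1..k}" by (auto simp: k)
        then have "increasing_blocks k' \<beta>"
          using Suc.prems(1) unfolding increasing_blocks_def by blast
        then have "bsums \<beta> k' \<in> S N" using Suc.prems(2) k old by (intro Suc.IH) auto
        moreover have "length (bsums \<beta> k') < m"
          using Suc.prems(2) k by (simp add: bsums_def del: upt_Suc)
        moreover have "bsums \<beta> k = z' N # bsums \<beta> k'"
          using sumD True by (simp add: k bsums_Suc)
        ultimately show ?thesis by (auto simp: z'(2) step_def)
      next
        case False
        define \<beta>' where "\<beta>' = \<beta>(k := D)"
        have sub': "\<beta>' j \<subseteq> \<beta> j" for j by (simp add: \<beta>'_def D_def)
        have "finite (\<beta>' j)" "\<beta>' j \<noteq> {}" "\<beta>' j \<subseteq> {1..N}" if "j \<in> {1..k}" for j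
          using block[OF that] old[of j] False fin Dsub that by (auto simp: \<beta>'_def k)
        note block' = this
        have "increasing_blocks k \<beta>'"
          unfolding increasing_blocks_def
        proof (intro conjI ballI impI)
          fix j assume j: "j \<in> {1..k}"
          show "finite (\<beta>' j)" "\<beta>' j \<noteq> {}" using block'[OF j] by blast+
          have "{1..N} \<subseteq> {1..}" by auto
          then show "\<beta>' j \<subseteq> {1..}" using block'(3)[OF j] by blast
        next
          fix i j a b assume "i \<in> {1..k}" "j \<in> {1..k}" "i < j" "a \<in> \<beta>' i" "b \<in> \<beta>' j"
          then show "a < b" using sub' less by blast
        qed
        then have "bsums \<beta>' k \<in> S N"
          by (rule Suc.IH[OF _ Suc.prems(2) block'(3)])
        moreover have "bsums \<beta>' k = (\<Sum>n\<in>D. z n) # bsums \<beta> k'"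
          using bsums_cong[of k' \<beta>' \<beta>] by (simp add: k bsums_Suc \<beta>'_def)
        moreover have "bsums \<beta> k = ((\<Sum>n\<in>D. z n) + z' N) # bsums \<beta> k'"
          using sumD by (simp add: k bsums_Suc)
        ultimately show ?thesis by (simp add: z'(2) step_add)
      qed
    qed
  qed

  show thesis
  proof (rule that[OF i(1), of z])
    show "z n \<ge> 1" for n unfolding z_def by (rule z'(1))
    fix \<beta> assume \<beta>: "increasing_blocks m \<beta>"
    \<comment> \<open>For \<open>m = 0\<close> this is the maximum of the empty set, but then no
      block has to be bounded by \<open>N\<close>.\<close>
    define N where "N = Max (\<Union>j\<in>{1..m}. \<beta> j)"
    have fin: "finite (\<Union>j\<in>{1..m}. \<beta> j)"
      using \<beta> unfolding increasing_blocks_def by (intro finite_UN_I) blast+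
    have "\<beta> j \<subseteq> {1..N}" if j: "j \<in> {1..m}" for j
    proof
      fix n assume n: "n \<in> \<beta> j"
      then have "n \<le> N" unfolding N_def using j by (intro Max_ge[OF fin]) blast
      moreover have "n \<in> {1..}" using \<beta> j n unfolding increasing_blocks_def by blast
      ultimately show "n \<in> {1..N}" by simp
    qed
    from bsums_in[OF \<beta> order_refl this] have "good p Q (bsums \<beta> m)"
      using S(1) by (auto simp: Inv_def)
    then have "Q (bsums \<beta> m)" by (rule good_imp)
    moreover have "length (bsums \<beta> m) = m" by (simp add: bsums_def del: upt_Suc)
    ultimately show "C i (map (\<lambda>j. \<Sum>n\<in>\<beta> j. z n) [1..<Suc m])"
      by (simp add: Q_def bsums_def rev_map del: upt_Suc)
  qed
qed

section \<open>Scaling polynomials\<close>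

text \<open>This permits evaluation at a list of length \<open>m\<close>, whose entries outside the
  range 1 to \<open>m\<close> are unspecified.\<close>

lemma mpoly_eval_cong:
  assumes "\<forall>e\<in>Poly_Mapping.keys f. Poly_Mapping.keys e \<subseteq> {1..m}"
    and "\<And>j. j \<in> {1..m} \<Longrightarrow> s j = t j"
  shows "mpoly_eval f s = mpoly_eval f t"
  unfolding mpoly_eval_def
proof (rule sum.cong[OF refl])
  fix e assume "e \<in> Poly_Mapping.keys f"
  then have "s j = t j" if "j \<in> Poly_Mapping.keys e" for j
    using assms that by blast
  then show "Poly_Mapping.lookup f e *
      (\<Prod>j\<in>Poly_Mapping.keys e. of_nat (s j) ^ Poly_Mapping.lookup e j) =
    Poly_Mapping.lookup f e *
      (\<Prod>j\<in>Poly_Mapping.keys e. of_nat (t j) ^ Poly_Mapping.lookup e j)"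
    by simp
qed

text \<open>A monomial of degree \<open>d\<close> contributes \<open>b ^ d\<close> from the
  arguments of \<open>g\<close>, which turns the coefficient factor \<open>(a / b) ^ d\<close> into
  \<open>a ^ d\<close>.\<close>

lemma mpoly_eval_scale:
  fixes a b :: nat
  assumes "b > 0" and "a > 0"
    and coeff: "\<And>e. Poly_Mapping.lookup g e =
      (of_nat a / of_nat b) ^ exp_sum e * Poly_Mapping.lookup f e"
  shows "mpoly_eval g (\<lambda>j. b * s j) = mpoly_eval f (\<lambda>j. a * s j)"
proof -
  \<comment> \<open>The factor \<open>a / b\<close> is nonzero, so no monomial is lost or
    gained.\<close>
  have keys: "Poly_Mapping.keys g = Poly_Mapping.keys f"
    using assms by (auto simp: in_keys_iff)
  have monomial: "(\<Prod>j\<in>Poly_Mapping.keys e. rat_of_nat (c * s j) ^ Poly_Mapping.lookup e j) =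
      of_nat c ^ exp_sum e * (\<Prod>j\<in>Poly_Mapping.keys e. of_nat (s j) ^ Poly_Mapping.lookup e j)"
    for c and e :: "nat \<Rightarrow>\<^sub>0 nat"
    by (simp add: power_mult_distrib prod.distrib exp_sum_def power_sum)
  show ?thesis
    unfolding mpoly_eval_def keys monomial coeff
    using assms(1) by (intro sum.cong) (auto simp: power_divide)
qed

section \<open>Transfer to polynomial Milliken-Taylor systems\<close>

theorem theorem3p5:
  fixes r m :: nat and f g :: mpoly_rat and A :: "nat \<Rightarrow> nat set"
  assumes "r \<ge> 1" and "m \<ge> 1"
    and "pos_valued_poly m f" and "pos_valued_poly m g"
    and "no_constant_term f" and "no_constant_term g"
    and "f \<approx>\<^sub>p g"
    and "coloring r A"
  shows "\<exists>x y :: nat \<Rightarrow> nat. (\<forall>n\<ge>1. x n \<ge> 1) \<and> (\<forall>n\<ge>1. y n \<ge> 1) \<and>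
    (\<exists>i\<in>{1..r}. MT m f x \<union> MT m g y \<subseteq> of_nat ` A i)"
proof -
  obtain \<alpha> :: rat where \<alpha>: "\<alpha> > 0"
    and lookup: "\<And>e. Poly_Mapping.lookup g e = \<alpha> ^ exp_sum e * Poly_Mapping.lookup f e"
    using assms(7) by (auto simp: poly_equiv_def)
  obtain a b :: nat where ab: "a > 0" "b > 0" "\<alpha> = of_nat a / of_nat b"
  proof -
    obtain p q where pq: "quotient_of \<alpha> = (p, q)" by fastforce
    have "q > 0" "\<alpha> = of_int p / of_int q"
      using quotient_of_denom_pos[OF pq] quotient_of_div[OF pq] by auto
    moreover from this \<alpha> have "p > 0" by (simp add: zero_less_divide_iff)
    ultimately show thesis by (intro that[of "nat p" "nat q"]) auto
  qed
  have keys: "\<forall>e\<in>Poly_Mapping.keys f. Poly_Mapping.keys e \<subseteq> {1..m}"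
    using assms(3) by (simp add: pos_valued_poly_def)
  \<comment> \<open>A tuple is coloured by the value of \<open>f\<close> at its
    \<open>a\<close>-fold multiple. Variables are numbered from 1 and list positions from 0, whence
    \<open>j - 1\<close>.\<close>
  define C where "C i l \<longleftrightarrow> mpoly_eval f (\<lambda>j. a * l ! (j - 1)) \<in> of_nat ` A i" for i l
  have "\<exists>i\<in>{1..r}. C i l" if l: "length l = m" "\<forall>n\<in>set l. n \<ge> 1" for l
  proof -
    have "a * l ! (j - 1) \<in> {1..}" if "j \<in> {1..m}" for j
    proof -
      have "l ! (j - 1) \<in> set l" using that l(1) by (intro nth_mem) auto
      with l(2) ab(1) show ?thesis by (simp add: Suc_le_eq)
    qed
    then have "mpoly_eval f (\<lambda>j. a * l ! (j - 1)) \<in> of_nat ` {1..}"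
      using assms(3) unfolding pos_valued_poly_def by simp
    then show ?thesis using assms(8) unfolding C_def coloring_def by blast
  qed
  then obtain i z where i: "i \<in> {1..r}" and z: "\<And>n. z n \<ge> 1"
    and mono: "\<And>\<beta>. increasing_blocks m \<beta> \<Longrightarrow>
      C i (map (\<lambda>j. \<Sum>n\<in>\<beta> j. z n) [1..<Suc m])"
    using Milliken_Taylor[of "{1..r}" m C] by blast
  have mem: "mpoly_eval f (\<lambda>j. a * (\<Sum>n\<in>\<beta> j. z n)) \<in> of_nat ` A i"
    if "increasing_blocks m \<beta>" for \<beta>
  proof -
    have "mpoly_eval f (\<lambda>j. a * (\<Sum>n\<in>\<beta> j. z n)) =
        mpoly_eval f (\<lambda>j. a * map (\<lambda>j. \<Sum>n\<in>\<beta> j. z n) [1..<Suc m] ! (j - 1))"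
      by (rule mpoly_eval_cong[OF keys]) (auto simp del: upt_Suc)
    with mono[OF that] show ?thesis by (simp add: C_def)
  qed
  \<comment> \<open>Scaling the sequence scales every block sum, so these are the coloured values
    from \<open>mem\<close>. For \<open>g\<close> and \<open>b\<close>,
    \<open>mpoly_eval_scale\<close> leads back to the same values of \<open>f\<close>.\<close>
  have "MT m f (\<lambda>n. a * z n) \<subseteq> of_nat ` A i"
    using mem increasing_blocksI by (fastforce simp: MT_def sum_distrib_left[symmetric])
  moreover have "MT m g (\<lambda>n. b * z n) \<subseteq> of_nat ` A i"
    using mem increasing_blocksI
    by (fastforce simp: MT_def sum_distrib_left[symmetric]
        mpoly_eval_scale[OF ab(2,1) lookup[unfolded ab(3)]])
  ultimately show ?thesis
    using i z ab(1,2)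
    by (intro exI[of _ "\<lambda>n. a * z n"] exI[of _ "\<lambda>n. b * z n"]) (auto simp: Suc_le_eq)
qed

end
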